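(* Let $T\in \mathcal{B}_A(\mathcal{H})$. Then $$d\omega_A(T) \leq \left[\omega_A\Big((T^\sharp T)^2 + (T^\sharp T)^4\Big)+ 2\,\omega_A^2\big(T^\sharp T^2\big)\right]^{\frac{1}{4}}.$$
   Context: $\mathcal{H}$ is a complex Hilbert space with inner product $\langle\cdot\mid\cdot\rangle$, $\mathcal{B}(\mathcal{H})$ is the algebra of bounded linear operators on $\mathcal{H}$, and $A\in\mathcal{B}(\mathcal{H})$ is a fixed nonzero positive (semidefinite) operator. Put $\langle x\mid y\rangle_A=\langle Ax\mid y\rangle$ and $\|x\|_A=\langle x\mid x\rangle_A^{1/2}$. $\mathcal{B}_A(\mathcal{H})=\{T\in\mathcal{B}(\mathcal{H}) : \mathcal{R}(T^*A)\subseteq\mathcal{R}(A)\}$, where $\mathcal{R}$ denotes range; for $T\in\mathcal{B}_A(\mathcal{H})$, $T^\sharp$ denotes the unique $X\in\mathcal{B}(\mathcal{H})$ with $AX=T^*A$ and $\mathcal{R}(X)\subseteq\overline{\mathcal{R}(A)}$ (so $\langle Tx\mid y\rangle_A=\langle x\mid T^\sharp y\rangle_A$); $T^\sharp T^2$ means the product $T^\sharp\cdot T\cdot T$. For $T\in\mathcal{B}_A(\mathcal{H})$: $\omega_A(T)=\sup\{|\langle Tx\mid x\rangle_A| : \|x\|_A=1\}$, and the $A$-Davis-Wielandt radius is $d\omega_A(T)=\sup\{\sqrt{|\langle Tx\mid x\rangle_A|^2+\|Tx\|_A^4} : \|x\|_A=1\}$; both are finite. *)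

theory Defs
  imports "HOL-Analysis.Analysis"
begin

class complex_vector = real_vector +
  fixes scaleC :: "complex \<Rightarrow> 'a \<Rightarrow> 'a"  (infixr "*\<^sub>C" 75)
  assumes scaleC_add_right: "c *\<^sub>C (x + y) = c *\<^sub>C x + c *\<^sub>C y"
    and scaleC_add_left: "(c + d) *\<^sub>C x = c *\<^sub>C x + d *\<^sub>C x"
    and scaleC_scaleC: "c *\<^sub>C d *\<^sub>C x = (c * d) *\<^sub>C x"
    and scaleC_one: "1 *\<^sub>C x = x"
    and scaleC_of_real: "complex_of_real r *\<^sub>C x = r *\<^sub>R x"

text \<open>The inner product is linear in the first argument. Its positive definiteness, and the fact
  that the norm is the square root of \<open>cinner x x\<close>, come from \<open>real_inner\<close>: the real inner
  product is the real part of \<open>cinner\<close>, and \<open>cinner x x\<close> is real by conjugate symmetry.\<close>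

class complex_inner = complex_vector + real_inner +
  fixes cinner :: "'a \<Rightarrow> 'a \<Rightarrow> complex"
  assumes cinner_commute: "cinner x y = cnj (cinner y x)"
    and cinner_add_left: "cinner (x + y) z = cinner x z + cinner y z"
    and cinner_scaleC_left: "cinner (c *\<^sub>C x) y = c * cinner x y"
    and Re_cinner: "Re (cinner x y) = inner x y"

class complex_hilbert = complex_inner + complete_space

definition bounded_clinear :: "('a::complex_inner \<Rightarrow> 'b::complex_inner) \<Rightarrow> bool" where
  "bounded_clinear T \<longleftrightarrow> bounded_linear T \<and> (\<forall>c x. T (c *\<^sub>C x) = c *\<^sub>C T x)"

text \<open>On a Hilbert space, the operator defined below exists uniquely for every bounded \<open>T\<close>, by the
  Riesz representation theorem.\<close>

definition cadjoint :: "('a::complex_inner \<Rightarrow> 'b::complex_inner) \<Rightarrow> 'b \<Rightarrow> 'a" where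
  "cadjoint T = (THE S. \<forall>x y. cinner (T x) y = cinner x (S y))"

definition positive_op :: "('a::complex_inner \<Rightarrow> 'a) \<Rightarrow> bool" where
  "positive_op A \<longleftrightarrow> bounded_clinear A \<and> (\<forall>x. cinner (A x) x \<in> \<real>\<^sub>\<ge>\<^sub>0)"

definition inner_A :: "('a::complex_inner \<Rightarrow> 'a) \<Rightarrow> 'a \<Rightarrow> 'a \<Rightarrow> complex" where
  "inner_A A x y = cinner (A x) y"

text \<open>For positive \<open>A\<close> the number \<open>inner_A A x x\<close> is real, so \<open>Re\<close> is a mere coercion.\<close>

definition norm_A :: "('a::complex_inner \<Rightarrow> 'a) \<Rightarrow> 'a \<Rightarrow> real" where
  "norm_A A x = sqrt (Re (inner_A A x x))"

definition B_A :: "('a::complex_inner \<Rightarrow> 'a) \<Rightarrow> ('a \<Rightarrow> 'a) set" where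
  "B_A A = {T. bounded_clinear T \<and> range (cadjoint T \<circ> A) \<subseteq> range A}"

text \<open>For positive \<open>A\<close> and \<open>T \<in> B_A A\<close> on a Hilbert space, the operator defined below exists
  uniquely, by Douglas' range inclusion theorem.\<close>

definition sharp :: "('a::complex_inner \<Rightarrow> 'a) \<Rightarrow> ('a \<Rightarrow> 'a) \<Rightarrow> 'a \<Rightarrow> 'a" where
  "sharp A T = (THE X. bounded_clinear X \<and> A \<circ> X = cadjoint T \<circ> A
                  \<and> range X \<subseteq> closure (range A))"

text \<open>For positive \<open>A \<noteq> 0\<close> and \<open>T \<in> B_A A\<close> on a Hilbert space, the two suprema are taken over
  nonempty sets of reals that are bounded above.\<close>

definition omega_A :: "('a::complex_inner \<Rightarrow> 'a) \<Rightarrow> ('a \<Rightarrow> 'a) \<Rightarrow> real" where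
  "omega_A A T = (SUP x\<in>{x. norm_A A x = 1}. cmod (inner_A A (T x) x))"

definition domega_A :: "('a::complex_inner \<Rightarrow> 'a) \<Rightarrow> ('a \<Rightarrow> 'a) \<Rightarrow> real" where
  "domega_A A T = (SUP x\<in>{x. norm_A A x = 1}.
     sqrt ((cmod (inner_A A (T x) x))\<^sup>2 + norm_A A (T x) ^ 4))"

end

theory Submission
  imports Defs
begin

text \<open>Write \<open>S\<close> for the product of \<open>sharp A T\<close> and \<open>T\<close>. Both terms under the square root defining
  \<open>domega_A A T\<close> are squared moduli of products with \<open>x\<close>, namely of \<open>T x\<close> and \<open>S x\<close>. For
  \<open>norm_A A x = 1\<close>, bounding the operator norm of the Gram matrix of \<open>T x\<close> and \<open>S x\<close> by its
  Frobenius norm bounds the square of their sum by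
  \<open>norm_A A (T x) ^ 4 + norm_A A (S x) ^ 4 + 2 * (cmod (inner_A A (T x) (S x)))\<^sup>2\<close>. By
  Cauchy-Schwarz the first two terms are at most the values at \<open>x\<close> of the forms of \<open>S ^^ 2\<close> and
  \<open>S ^^ 4\<close>, and the cross term has the modulus of the form of \<open>S \<circ> T\<close> at \<open>x\<close>.

  Since suprema and definite descriptions are involved, one also needs that \<open>sharp A T\<close> exists as
  a bounded operator (Riesz representation, orthogonal projection and uniform boundedness) and that
  \<open>S\<close> is bounded for the seminorm \<open>norm_A A\<close>.\<close>

section \<open>Hilbert space preliminaries\<close>

text \<open>A minimizing sequence for the distance from \<open>x\<close> to \<open>M\<close> is
  Cauchy by the parallelogram law; the first variation at its limit gives orthogonality.\<close>

lemma closed_subspace_projection: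
  fixes M :: "'a::{real_inner, complete_space} set"
  assumes "closed M" and "subspace M"
  obtains p where "p \<in> M" and "\<And>m. m \<in> M \<Longrightarrow> inner (x - p) m = 0"
proof -
  define D where "D = (INF m\<in>M. (norm (x - m))\<^sup>2)"
  have bdd: "bdd_below ((\<lambda>m. (norm (x - m))\<^sup>2) ` M)"
    by (rule bdd_belowI2[where m = 0]) simp
  have ne: "M \<noteq> {}" using subspace_0[OF assms(2)] by auto
  have D_le: "D \<le> (norm (x - m))\<^sup>2" if "m \<in> M" for m
    unfolding D_def using bdd that by (rule cINF_lower)
  have "\<exists>m\<in>M. (norm (x - m))\<^sup>2 < D + 1 / real (Suc n)" for n
  proof -
    have "D < D + 1 / real (Suc n)" by simp
    then show ?thesis unfolding D_def using cINF_less_iff[OF ne bdd] by metis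
  qed
  then obtain s where sM: "s n \<in> M" and s: "(norm (x - s n))\<^sup>2 < D + 1 / real (Suc n)" for n
    by metis
  \<comment> \<open>Parallelogram law for \<open>x - a\<close> and \<open>x - b\<close>. The
    midpoint of two members of \<open>M\<close> again lies in \<open>M\<close>, so its squared
    distance to \<open>x\<close> is at least \<open>D\<close>; this makes near-minimizers close to
    each other.\<close>
  have par: "(norm (a - b))\<^sup>2 = 2 * (norm (x - a))\<^sup>2 + 2 * (norm (x - b))\<^sup>2
      - 4 * (norm (x - (1/2) *\<^sub>R (a + b)))\<^sup>2" for a b
    by (simp add: power2_norm_eq_inner inner_simps inner_commute algebra_simps)
  have gap: "(norm (s m - s n))\<^sup>2 \<le> 2 * (1 / real (Suc m)) + 2 * (1 / real (Suc n))" for m n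
  proof -
    have "(1/2) *\<^sub>R (s m + s n) \<in> M"
      using assms(2) sM by (simp add: subspace_add subspace_scale)
    from D_le[OF this] s[of m] s[of n] show ?thesis
      unfolding par[of "s m" "s n"] by linarith
  qed
  have "Cauchy s"
  proof (rule metric_CauchyI)
    fix e :: real assume e: "0 < e"
    obtain N where N: "4 / e\<^sup>2 < real N" using reals_Archimedean2 by blast
    show "\<exists>M. \<forall>m\<ge>M. \<forall>n\<ge>M. dist (s m) (s n) < e"
    proof (intro exI allI impI)
      fix m n assume mn: "N \<le> m" "N \<le> n"
      have N0: "0 < real N" using N e by (meson divide_pos_pos less_trans zero_less_numeral zero_less_power)
      have "2 / real (Suc m) \<le> 2 / real N" "2 / real (Suc n) \<le> 2 / real N"
        using mn N0 by (auto intro!: divide_left_mono)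
      with gap[of m n] have "(norm (s m - s n))\<^sup>2 \<le> 4 / real N" by simp
      also have "\<dots> < e\<^sup>2" using N N0 e by (simp add: field_simps)
      finally show "dist (s m) (s n) < e"
        using e by (simp add: dist_norm power_less_imp_less_base)
    qed
  qed
  then obtain p where p: "s \<longlonglongrightarrow> p" using Cauchy_convergent_iff convergent_def by metis
  have pM: "p \<in> M" using assms(1) sM p closed_sequentially by blast
  have "(\<lambda>n. D + 1 / real (Suc n)) \<longlonglongrightarrow> D + 0"
    by (intro tendsto_intros LIMSEQ_Suc lim_1_over_n)
  moreover have "(\<lambda>n. (norm (x - s n))\<^sup>2) \<longlonglongrightarrow> (norm (x - p))\<^sup>2"
    by (intro tendsto_intros p)
  ultimately have pD: "(norm (x - p))\<^sup>2 \<le> D"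
    using s by (intro LIMSEQ_le[where X = "\<lambda>n. (norm (x - s n))\<^sup>2"]) (auto intro: less_imp_le)
  have "inner (x - p) m = 0" if m: "m \<in> M" for m
  proof (rule ccontr)
    assume c: "inner (x - p) m \<noteq> 0"
    define i where "i = inner (x - p) m"
    \<comment> \<open>This \<open>t\<close> minimizes the squared norm of
      \<open>(x - p) - t *\<^sub>R m\<close>, which drops by
      \<open>i\<^sup>2 / inner m m\<close>.\<close>
    define t where "t = i / (inner m m)"
    have m0: "inner m m > 0" using c by (metis inner_gt_zero_iff inner_zero_right)
    have "p + t *\<^sub>R m \<in> M" using assms(2) pM m by (simp add: subspace_add subspace_scale)
    from order_trans[OF pD D_le[OF this]]
    have "(norm (x - p))\<^sup>2 \<le> (norm ((x - p) - t *\<^sub>R m))\<^sup>2" by (simp add: algebra_simps)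
    also have "\<dots> = (norm (x - p))\<^sup>2 - 2 * t * i + t\<^sup>2 * inner m m"
      unfolding power2_norm_eq_inner i_def
      by (simp add: inner_diff inner_commute power2_eq_square)
    also have "\<dots> = (norm (x - p))\<^sup>2 - i\<^sup>2 / inner m m"
      using m0 by (simp add: t_def power2_eq_square field_simps)
    finally have "i\<^sup>2 / inner m m \<le> 0" by simp
    moreover have "0 < i\<^sup>2 / inner m m" using m0 c by (intro divide_pos_pos) (simp_all only: i_def zero_less_power2 not_False_eq_True)
    ultimately show False by simp
  qed
  with pM that show thesis by blast
qed

text \<open>Subtracting from \<open>x0\<close> its projection onto the kernel of \<open>f\<close>
  leaves a vector \<open>w\<close> orthogonal to that kernel, and every vector is a multiple of
  \<open>w\<close> plus a kernel element.\<close>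

lemma riesz_representation:
  fixes f :: "'a::{real_inner, complete_space} \<Rightarrow> real"
  assumes "bounded_linear f"
  shows "\<exists>y. \<forall>x. f x = inner x y"
proof (cases "\<forall>x. f x = 0")
  case True
  then show ?thesis by (intro exI[of _ 0]) simp
next
  case False
  interpret f: bounded_linear f by fact
  from False obtain x0 where x0: "f x0 \<noteq> 0" by blast
  define N where "N = {x. f x = 0}"
  have "closed N" unfolding N_def by (intro closed_Collect_eq continuous_intros f.continuous_on)
  moreover have "subspace N" by (auto simp: N_def subspace_def f.add f.scaleR f.zero)
  ultimately obtain p where p: "p \<in> N" and orth: "\<And>m. m \<in> N \<Longrightarrow> inner (x0 - p) m = 0"
    using closed_subspace_projection[of N x0] by blast
  define w where "w = x0 - p"
  have fw: "f w \<noteq> 0" using x0 p by (simp add: w_def f.diff N_def)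
  then have ww: "inner w w \<noteq> 0" using f.zero by auto
  have "f x = inner x ((f w / inner w w) *\<^sub>R w)" for x
  proof -
    have "x - (f x / f w) *\<^sub>R w \<in> N" using fw by (simp add: N_def f.diff f.scaleR)
    then have "inner w (x - (f x / f w) *\<^sub>R w) = 0" using orth w_def by blast
    then show ?thesis using fw ww by (simp add: inner_diff inner_commute field_simps)
  qed
  then show ?thesis by blast
qed

text \<open>By Baire, one of the closed sets \<open>E n\<close> contains a ball. Subtracting the
  value at its centre moves the bound to vectors of norm \<open>r\<close>, which yields the factor
  \<open>2 * real n / r\<close>.\<close>

lemma uniform_boundedness:
  fixes f :: "'i \<Rightarrow> 'a::{real_normed_vector, complete_space} \<Rightarrow> 'b::real_normed_vector"
  assumes lin: "\<And>i. i \<in> I \<Longrightarrow> bounded_linear (f i)"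
    and bdd: "\<And>x. \<exists>K. \<forall>i\<in>I. norm (f i x) \<le> K"
  shows "\<exists>K. \<forall>i\<in>I. \<forall>x. norm (f i x) \<le> K * norm x"
proof -
  define E where "E n = {x. \<forall>i\<in>I. norm (f i x) \<le> real n}" for n :: nat
  have "closed (E n)" for n
  proof -
    have "E n = (\<Inter>i\<in>I. {x. norm (f i x) \<le> real n})" by (auto simp: E_def)
    moreover have "closed {x. norm (f i x) \<le> real n}" if "i \<in> I" for i
      by (intro closed_Collect_le continuous_intros bounded_linear.continuous_on[OF lin[OF that]])
    ultimately show ?thesis by auto
  qed
  moreover have "(\<Union>n. E n) = UNIV"
  proof -
    have "\<exists>n. x \<in> E n" for x
    proof -
      obtain K where K: "\<forall>i\<in>I. norm (f i x) \<le> K" using bdd by blast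
      obtain n where "K \<le> real n" using real_arch_simple by blast
      with K show ?thesis unfolding E_def by (intro exI[of _ n]) force
    qed
    then show ?thesis by auto
  qed
  ultimately have "\<exists>n. interior (E n) \<noteq> {}"
    using Baire_category_alt[of euclidean "range E"]
    by (auto simp: completely_metrizable_space_euclidean)
  then obtain n x0 where "x0 \<in> interior (E n)" by blast
  then obtain r where r: "r > 0" and sub: "cball x0 r \<subseteq> E n" by (meson mem_interior_cball)
  have "norm (f i x) \<le> (2 * real n / r) * norm x" if i: "i \<in> I" for i x
  proof (cases "x = 0")
    case True
    then show ?thesis using linear_0[OF bounded_linear.linear[OF lin[OF i]]] by simp
  next
    case False
    interpret f: bounded_linear "f i" by (rule lin[OF i])
    define y where "y = (r / norm x) *\<^sub>R x"
    have ny: "norm y = r" using False r by (simp add: y_def)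
    have "x0 \<in> cball x0 r" "x0 + y \<in> cball x0 r" using r ny by (auto simp: dist_norm)
    with sub i have "norm (f i x0) \<le> n" "norm (f i (x0 + y)) \<le> n" unfolding E_def by blast+
    moreover have "f i y = f i (x0 + y) - f i x0" by (simp add: f.add)
    ultimately have "norm (f i y) \<le> 2 * real n"
      by (smt (verit) norm_triangle_ineq4)
    moreover have "norm (f i y) = (r / norm x) * norm (f i x)"
      using r by (simp add: y_def f.scaleR)
    ultimately show ?thesis using False r by (simp add: field_simps)
  qed
  then show ?thesis by blast
qed

section \<open>Complex inner product spaces\<close>

lemma cinner_add_right: "cinner x (y + z) = cinner x y + cinner x (z::'a::complex_inner)"
  by (metis cinner_add_left cinner_commute complex_cnj_add)

lemma cinner_scaleC_right: "cinner x (c *\<^sub>C y) = cnj c * cinner x (y::'a::complex_inner)"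
  by (metis cinner_commute cinner_scaleC_left complex_cnj_mult)

lemma cinner_eqI:
  fixes x y :: "'a::complex_inner"
  assumes "\<And>z. cinner x z = cinner y z"
  shows "x = y"
  using assms by (metis Re_cinner vector_eq_rdot)

lemma norm_scaleC: "norm (c *\<^sub>C x) = cmod c * norm (x::'a::complex_inner)"
proof -
  have "cinner (c *\<^sub>C x) (c *\<^sub>C x) = (c * cnj c) * cinner x x"
    by (simp add: cinner_scaleC_left cinner_scaleC_right mult_ac)
  then have "Re (cinner (c *\<^sub>C x) (c *\<^sub>C x)) = Re (of_real ((cmod c)\<^sup>2) * cinner x x)"
    by (simp only: complex_norm_square)
  then have "inner (c *\<^sub>C x) (c *\<^sub>C x) = (cmod c)\<^sup>2 * inner x x"
    by (simp add: Re_cinner flip: of_real_power)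
  then show ?thesis
    by (simp add: norm_eq_sqrt_inner real_sqrt_mult)
qed

lemma bounded_linear_scaleC: "bounded_linear (\<lambda>x::'a::complex_inner. c *\<^sub>C x)"
proof (rule bounded_linear_intro[where K = "cmod c"])
  show "c *\<^sub>C (r *\<^sub>R x) = r *\<^sub>R (c *\<^sub>C x)" for r and x :: 'a
    by (metis scaleC_of_real scaleC_scaleC mult.commute)
qed (simp_all add: scaleC_add_right norm_scaleC mult.commute)

lemma bounded_clinear_scaleC: "bounded_clinear T \<Longrightarrow> T (c *\<^sub>C x) = c *\<^sub>C T x"
  by (simp add: bounded_clinear_def)

lemma bounded_clinear_imp_bounded_linear: "bounded_clinear T \<Longrightarrow> bounded_linear T"
  by (simp add: bounded_clinear_def)

lemma bounded_clinear_compose: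
  "bounded_clinear S \<Longrightarrow> bounded_clinear T \<Longrightarrow> bounded_clinear (S \<circ> T)"
  by (simp add: bounded_clinear_def bounded_linear_compose o_def)

text \<open>The imaginary part at \<open>x\<close> is the real part at
  \<open>(- \<i>) *\<^sub>C x\<close>. Hence the real Riesz theorem suffices to produce complex
  adjoints.\<close>

lemma cinner_eq_if_inner_eq:
  assumes "bounded_clinear T" and eq: "\<And>x. inner (T x) y = inner x z"
  shows "cinner (T x) y = cinner x z"
proof (rule complex_eqI)
  show "Re (cinner (T x) y) = Re (cinner x z)" by (simp add: Re_cinner eq)
  have "Re (cinner (T ((- \<i>) *\<^sub>C x)) y) = Re (cinner ((- \<i>) *\<^sub>C x) z)"
    by (simp add: Re_cinner eq)
  then show "Im (cinner (T x) y) = Im (cinner x z)"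
    by (simp add: bounded_clinear_scaleC[OF assms(1)] cinner_scaleC_left)
qed

lemma cinner_cadjoint:
  fixes T :: "'a::complex_hilbert \<Rightarrow> 'b::complex_inner"
  assumes "bounded_clinear T"
  shows "cinner (T x) y = cinner x (cadjoint T y)"
proof -
  have bl: "bounded_linear (\<lambda>x. inner (T x) y)" for y
    by (intro bounded_linear_inner_left_comp bounded_clinear_imp_bounded_linear assms)
  obtain S where "\<And>x y. inner (T x) y = inner x (S y)"
    using riesz_representation[OF bl] by metis
  then have S: "\<forall>x y. cinner (T x) y = cinner x (S y)"
    using cinner_eq_if_inner_eq[OF assms] by blast
  moreover have "S' = S" if "\<forall>x y. cinner (T x) y = cinner x (S' y)" for S'
  proof
    fix y
    have "cinner x (S' y) = cinner x (S y)" for x using S that by simp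
    then show "S' y = S y" by (intro cinner_eqI) (metis cinner_commute)
  qed
  ultimately have "\<forall>x y. cinner (T x) y = cinner x (cadjoint T y)"
    unfolding cadjoint_def by (rule theI)
  then show ?thesis by blast
qed

lemma positive_op_bounded_clinear: "positive_op A \<Longrightarrow> bounded_clinear A"
  by (simp add: positive_op_def)

text \<open>Polarization: the quadratic form is real, so expanding it at \<open>x + y\<close> shows
  that the sum of the cross terms is real. Rotating \<open>x\<close> by \<i> turns this into
  equality of real parts.\<close>

lemma positive_op_symmetric:
  assumes "positive_op A"
  shows "cinner (A x) y = cinner x (A y)"
proof -
  note A = positive_op_bounded_clinear[OF assms]
  interpret bounded_linear A by (rule bounded_clinear_imp_bounded_linear[OF A])
  have im: "Im (cinner (A x) x) = 0" for x
    using assms complex_is_Real_iff nonneg_Reals_subset_Reals by (auto simp: positive_op_def)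
  have *: "Im (cinner (A x) y + cinner (A y) x) = 0" for x y
    using im[of "x + y"] im[of x] im[of y] by (simp add: add cinner_add_left cinner_add_right)
  have "inner (A x) y = inner x (A y)" for x y
    using *[of "\<i> *\<^sub>C x" y]
    by (simp add: bounded_clinear_scaleC[OF A] cinner_scaleC_left cinner_scaleC_right Re_cinner inner_commute)
  then show ?thesis by (intro cinner_eq_if_inner_eq A)
qed

lemma subspace_closure_range:
  fixes A :: "'a::real_normed_vector \<Rightarrow> 'b::real_normed_vector"
  assumes "bounded_linear A"
  shows "subspace (closure (range A))"
proof -
  interpret bounded_linear A by fact
  have sub: "subspace (range A)"
    by (rule linear_subspace_image[OF linear]) simp_all
  show ?thesis
    unfolding subspace_def
  proof (intro conjI ballI allI)
    show "0 \<in> closure (range A)" using sub closure_subset subspace_0 by blast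
    fix x y c assume x: "x \<in> closure (range A)"
    obtain f where f: "\<And>n. f n \<in> range A" "f \<longlonglongrightarrow> x" using x closure_sequential by blast
    { assume "y \<in> closure (range A)"
      then obtain g where "\<And>n. g n \<in> range A" "g \<longlonglongrightarrow> y" using closure_sequential by blast
      with f show "x + y \<in> closure (range A)"
        unfolding closure_sequential
        by (intro exI[of _ "\<lambda>n. f n + g n"]) (auto intro!: tendsto_add subspace_add[OF sub]) }
    show "c *\<^sub>R x \<in> closure (range A)"
      unfolding closure_sequential using f
      by (intro exI[of _ "\<lambda>n. c *\<^sub>R f n"]) (auto intro!: tendsto_scaleR subspace_scale[OF sub])
  qed
qed

text \<open>Serves the complex homogeneity of the operator built in \<open>sharp_properties\<close>,
  whose values lie in this closure.\<close>

lemma closure_range_scaleC: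
  assumes "bounded_clinear A" and "x \<in> closure (range A)"
  shows "c *\<^sub>C x \<in> closure (range A)"
proof -
  have "(\<lambda>x. c *\<^sub>C x) ` closure (range A) \<subseteq> closure ((\<lambda>x. c *\<^sub>C x) ` range A)"
    by (rule closure_bounded_linear_image_subset[OF bounded_linear_scaleC])
  also have "\<dots> \<subseteq> closure (range A)"
    by (rule closure_mono) (auto simp flip: bounded_clinear_scaleC[OF assms(1)])
  finally show ?thesis using assms(2) by blast
qed

section \<open>The operator \<open>sharp A T\<close>\<close>

text \<open>\<open>A\<close> is injective on the closure \<open>M\<close> of its range, so
  projecting preimages onto \<open>M\<close> solves the defining equation uniquely. Boundedness
  comes from the uniform boundedness principle.\<close>

lemma sharp_properties:
  fixes A T :: "'a::complex_hilbert \<Rightarrow> 'a"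
  assumes "positive_op A" and "T \<in> B_A A"
  shows "bounded_clinear (sharp A T)" and "A \<circ> sharp A T = cadjoint T \<circ> A"
proof -
  note A = positive_op_bounded_clinear[OF assms(1)]
  note symA = positive_op_symmetric[OF assms(1)]
  interpret A: bounded_linear A by (rule bounded_clinear_imp_bounded_linear[OF A])
  have T: "bounded_clinear T" and ran: "range (cadjoint T \<circ> A) \<subseteq> range A"
    using assms(2) by (auto simp: B_A_def)
  define M where "M = closure (range A)"
  have clM: "closed M" and subM: "subspace M"
    using subspace_closure_range[OF A.bounded_linear_axioms] by (auto simp: M_def)
  have scM: "c *\<^sub>C y \<in> M" if "y \<in> M" for c y
    using closure_range_scaleC[OF A] that by (simp add: M_def)
  have AM: "A x \<in> M" for x using closure_subset[of "range A"] by (auto simp: M_def)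
  have inner_A_sym: "inner (A x) y = inner x (A y)" for x y using symA by (metis Re_cinner)
  \<comment> \<open>The difference lies in the kernel of \<open>A\<close>, hence is orthogonal to
    \<open>range A\<close> and to its closure \<open>M\<close>; it also lies in \<open>M\<close>, so
    it vanishes.\<close>
  have inj: "y = y'" if "y \<in> M" "y' \<in> M" "A y = A y'" for y y'
  proof -
    have "A (y - y') = 0" using that by (simp add: A.diff)
    then have "range A \<subseteq> {m. inner (y - y') m = 0}"
      by (auto simp flip: inner_A_sym)
    then have "M \<subseteq> {m. inner (y - y') m = 0}"
      unfolding M_def by (intro closure_minimal closed_Collect_eq continuous_intros)
    moreover have "y - y' \<in> M" using subM that by (simp add: subspace_diff)
    ultimately show ?thesis by auto
  qed
  \<comment> \<open>Projecting a preimage \<open>z\<close> onto \<open>M\<close> does not change its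
    image: \<open>z - p\<close> is orthogonal to \<open>range A\<close>, and by symmetry
    \<open>A\<close> annihilates it.\<close>
  have ex: "\<exists>y\<in>M. A y = cadjoint T (A x)" for x
  proof -
    have "cadjoint T (A x) \<in> range A" using ran by auto
    then obtain z where z: "A z = cadjoint T (A x)" by (metis rangeE)
    obtain p where p: "p \<in> M" "\<And>m. m \<in> M \<Longrightarrow> inner (z - p) m = 0"
      using closed_subspace_projection[OF clM subM, of z] by blast
    have "inner (A (z - p)) (A (z - p)) = 0"
      by (subst inner_A_sym) (rule p(2)[OF AM])
    then have "A p = A z" by (simp add: A.diff)
    with p(1) z show ?thesis by auto
  qed
  then obtain X where XM: "\<And>x. X x \<in> M" and AX: "\<And>x. A (X x) = cadjoint T (A x)" by metis
  have adj: "cinner (A (X x)) u = cinner (A x) (T u)" for x u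
    unfolding AX by (metis cinner_cadjoint[OF T] cinner_commute)
  \<comment> \<open>\<open>X\<close> was chosen pointwise, so its linearity comes from
    \<open>inj\<close>: both sides lie in \<open>M\<close> and have the same image under
    \<open>A\<close>.\<close>
  have X_add: "X (x + y) = X x + X y" for x y
  proof (rule inj)
    show "A (X (x + y)) = A (X x + X y)"
      by (rule cinner_eqI) (simp add: A.add cinner_add_left adj)
  qed (use XM subM in \<open>auto simp: subspace_add\<close>)
  have X_scaleC: "X (c *\<^sub>C x) = c *\<^sub>C X x" for c x
  proof (rule inj)
    show "A (X (c *\<^sub>C x)) = A (c *\<^sub>C X x)"
      by (rule cinner_eqI) (simp add: bounded_clinear_scaleC[OF A] cinner_scaleC_left adj)
  qed (use XM scM in auto)
  have inner_adj: "inner (X x) (A u) = inner (A x) (T u)" for x u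
    using adj by (metis Re_cinner inner_A_sym)
  \<comment> \<open>By \<open>inner_adj\<close>, the functional of \<open>x\<close> attached to each
    \<open>u\<close> is bounded although \<open>X\<close> is not yet known to be. Over
    \<open>I\<close> the functionals are pointwise bounded by \<open>norm (X x)\<close>.\<close>
  define I where "I = {u. norm (A u) \<le> 1}"
  have "\<exists>K. \<forall>u\<in>I. \<forall>x. norm (inner (X x) (A u)) \<le> K * norm x"
  proof (rule uniform_boundedness)
    show "bounded_linear (\<lambda>x. inner (X x) (A u))" for u
      unfolding inner_adj by (intro bounded_linear_inner_left_comp A.bounded_linear_axioms)
    show "\<exists>K. \<forall>u\<in>I. norm (inner (X x) (A u)) \<le> K" for x
    proof (intro exI[of _ "norm (X x)"] ballI)
      fix u assume "u \<in> I"
      then have "norm (X x) * norm (A u) \<le> norm (X x) * 1"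
        unfolding I_def by (intro mult_left_mono) auto
      with Cauchy_Schwarz_ineq2[of "X x" "A u"] show "norm (inner (X x) (A u)) \<le> norm (X x)" by simp
    qed
  qed
  then obtain K where K: "\<And>u x. norm (A u) \<le> 1 \<Longrightarrow> \<bar>inner (X x) (A u)\<bar> \<le> K * norm x"
    by (auto simp: I_def)
  have K': "\<bar>inner (X x) (A u)\<bar> \<le> K * norm x * norm (A u)" for x u
  proof (cases "A u = 0")
    case False
    then show ?thesis
      using K[of "(1 / norm (A u)) *\<^sub>R u" x] by (simp add: A.scaleR field_simps)
  qed simp
  \<comment> \<open>The bound extends from \<open>range A\<close> to its closure, so it may be
    tested against \<open>X x\<close> itself.\<close>
  have bdX: "norm (X x) \<le> K * norm x" for x
  proof -
    have "range A \<subseteq> {m. \<bar>inner (X x) m\<bar> \<le> K * norm x * norm m}" using K' by auto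
    then have "M \<subseteq> {m. \<bar>inner (X x) m\<bar> \<le> K * norm x * norm m}"
      unfolding M_def by (intro closure_minimal closed_Collect_le continuous_intros)
    with XM[of x] have "\<bar>inner (X x) (X x)\<bar> \<le> K * norm x * norm (X x)" by blast
    then have "norm (X x) * norm (X x) \<le> K * norm x * norm (X x)"
      by (simp flip: power2_norm_eq_inner power2_eq_square)
    moreover have "0 \<le> K * norm x" using K[of 0 x] by simp
    ultimately show ?thesis by (cases "X x = 0") auto
  qed
  have "bounded_linear X"
  proof (rule bounded_linear_intro[where K = K])
    show "X (r *\<^sub>R x) = r *\<^sub>R X x" for r x by (metis X_scaleC scaleC_of_real)
  qed (use X_add bdX in \<open>auto simp: mult.commute\<close>)
  then have P: "bounded_clinear X \<and> A \<circ> X = cadjoint T \<circ> A \<and> range X \<subseteq> closure (range A)"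
    using X_scaleC AX XM by (auto simp: bounded_clinear_def M_def)
  have "bounded_clinear (sharp A T) \<and> A \<circ> sharp A T = cadjoint T \<circ> A
      \<and> range (sharp A T) \<subseteq> closure (range A)"
    unfolding sharp_def
  proof (rule theI[of _ X])
    fix Y
    assume Y: "bounded_clinear Y \<and> A \<circ> Y = cadjoint T \<circ> A \<and> range Y \<subseteq> closure (range A)"
    show "Y = X"
    proof
      fix x
      show "Y x = X x"
        by (rule inj) (use Y P in \<open>auto simp: M_def fun_eq_iff\<close>)
    qed
  qed (rule P)
  then show "bounded_clinear (sharp A T)" and "A \<circ> sharp A T = cadjoint T \<circ> A" by blast+
qed

section \<open>The semi-inner product induced by a positive operator\<close>

text \<open>The discriminant argument behind Cauchy-Schwarz for a seminorm, where \<open>d\<close>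
  may be 0. Then the expression is affine in \<open>s\<close> and forces \<open>b = 0\<close>;
  otherwise \<open>s = 1 / d\<close> is optimal.\<close>

lemma nonneg_quadratic_imp:
  fixes a b d :: real
  assumes "\<And>s. 0 \<le> a - 2 * s * b + s\<^sup>2 * b * d" and "0 \<le> b" and "0 \<le> d"
  shows "b \<le> a * d"
proof (cases "d = 0")
  case True
  have "b = 0"
  proof (rule ccontr)
    assume "b \<noteq> 0"
    \<comment> \<open>For \<open>d = 0\<close> this \<open>s\<close> gives the expression the value
      -1.\<close>
    with assms(1)[of "(a + 1) / (2 * b)"] assms(1)[of 0] True show False by simp
  qed
  with True show ?thesis by simp
next
  case False
  with assms(1)[of "1 / d"] assms(3) show ?thesis
    by (simp add: power2_eq_square field_simps)
qed

context
  fixes A :: "'a::complex_inner \<Rightarrow> 'a"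
  assumes A: "positive_op A"
begin

interpretation A: bounded_linear A
  by (rule bounded_clinear_imp_bounded_linear[OF positive_op_bounded_clinear[OF A]])

lemma inner_A_add_left: "inner_A A (x + y) z = inner_A A x z + inner_A A y z"
  by (simp add: inner_A_def A.add cinner_add_left)

lemma inner_A_add_right: "inner_A A x (y + z) = inner_A A x y + inner_A A x z"
  by (simp add: inner_A_def cinner_add_right)

lemma inner_A_scaleC_left: "inner_A A (c *\<^sub>C x) y = c * inner_A A x y"
  by (simp add: inner_A_def bounded_clinear_scaleC[OF positive_op_bounded_clinear[OF A]]
      cinner_scaleC_left)

lemma inner_A_scaleC_right: "inner_A A x (c *\<^sub>C y) = cnj c * inner_A A x y"
  by (simp add: inner_A_def cinner_scaleC_right)

lemma inner_A_commute: "inner_A A x y = cnj (inner_A A y x)"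
  unfolding inner_A_def by (metis positive_op_symmetric[OF A] cinner_commute)

lemma norm_A_nonneg: "0 \<le> norm_A A x"
  and inner_A_self: "inner_A A x x = of_real ((norm_A A x)\<^sup>2)"
proof -
  have *: "inner_A A x x \<in> \<real>\<^sub>\<ge>\<^sub>0" using A by (simp add: positive_op_def inner_A_def)
  then have 0: "0 \<le> Re (inner_A A x x)" by (auto elim: nonneg_Reals_cases)
  then show "0 \<le> norm_A A x" by (simp add: norm_A_def)
  show "inner_A A x x = of_real ((norm_A A x)\<^sup>2)"
    using * 0 by (auto simp: norm_A_def elim: nonneg_Reals_cases)
qed

lemma norm_A_le_norm: "\<exists>c\<ge>0. \<forall>x. norm_A A x \<le> c * norm x"
proof -
  obtain k where k: "k > 0" "\<And>x. norm (A x) \<le> norm x * k" using A.pos_bounded by blast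
  have "norm_A A x \<le> sqrt k * norm x" for x
  proof -
    have "Re (inner_A A x x) \<le> norm (A x) * norm x"
      unfolding inner_A_def Re_cinner by (rule norm_cauchy_schwarz)
    also have "\<dots> \<le> k * (norm x)\<^sup>2"
      using mult_right_mono[OF k(2)[of x], of "norm x"] by (simp add: power2_eq_square mult_ac)
    finally show ?thesis
      unfolding norm_A_def using real_sqrt_le_mono by (fastforce simp: real_sqrt_mult)
  qed
  then show ?thesis using k(1) by (intro exI[of _ "sqrt k"]) auto
qed

lemma inner_A_Cauchy_Schwarz: "cmod (inner_A A x y) \<le> norm_A A x * norm_A A y"
proof -
  define c where "c = inner_A A x y"
  have "0 \<le> (norm_A A x)\<^sup>2 - 2 * s * (cmod c)\<^sup>2 + s\<^sup>2 * (cmod c)\<^sup>2 * (norm_A A y)\<^sup>2" for s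
  proof -
    \<comment> \<open>The factor \<open>c\<close> aligns the phases, so that only a real parameter
      \<open>s\<close> remains to be varied.\<close>
    define z where "z = x + (- of_real s * c) *\<^sub>C y"
    have yx: "inner_A A y x = cnj c" using inner_A_commute c_def by metis
    have "inner_A A z z = inner_A A x x - 2 * of_real s * (c * cnj c)
        + (of_real s)\<^sup>2 * (c * cnj c) * inner_A A y y"
      unfolding z_def inner_A_add_left inner_A_add_right inner_A_scaleC_left inner_A_scaleC_right yx
        c_def[symmetric]
      by (simp add: algebra_simps power2_eq_square)
    then have "complex_of_real ((norm_A A z)\<^sup>2) = of_real ((norm_A A x)\<^sup>2 - 2 * s * (cmod c)\<^sup>2
        + s\<^sup>2 * (cmod c)\<^sup>2 * (norm_A A y)\<^sup>2)"
      unfolding inner_A_self complex_norm_square[symmetric] by simp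
    then have "(norm_A A z)\<^sup>2 = (norm_A A x)\<^sup>2 - 2 * s * (cmod c)\<^sup>2
        + s\<^sup>2 * (cmod c)\<^sup>2 * (norm_A A y)\<^sup>2"
      unfolding of_real_eq_iff .
    then show ?thesis by (metis zero_le_power2)
  qed
  then have "(cmod c)\<^sup>2 \<le> (norm_A A x * norm_A A y)\<^sup>2"
    unfolding power_mult_distrib by (intro nonneg_quadratic_imp) auto
  then show ?thesis
    unfolding c_def by (rule power2_le_imp_le) (simp add: norm_A_nonneg)
qed

text \<open>The Gram matrix of \<open>u, v\<close> has operator norm at most its Frobenius norm.\<close>

lemma Bessel_Frobenius:
  "((cmod (inner_A A u x))\<^sup>2 + (cmod (inner_A A v x))\<^sup>2)\<^sup>2
    \<le> norm_A A x ^ 4 * (norm_A A u ^ 4 + norm_A A v ^ 4 + 2 * (cmod (inner_A A u v))\<^sup>2)"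
proof -
  define a b g where "a = inner_A A u x" and "b = inner_A A v x" and "g = inner_A A u v"
  define s where "s = (cmod a)\<^sup>2 + (cmod b)\<^sup>2"
  define F where "F = norm_A A u ^ 4 + norm_A A v ^ 4 + 2 * (cmod g)\<^sup>2"
  \<comment> \<open>The coefficients make the product of \<open>w\<close> with \<open>x\<close>
    equal to \<open>s\<close>, so Cauchy-Schwarz reduces the claim to bounding
    \<open>norm_A A w\<close>.\<close>
  define w where "w = cnj a *\<^sub>C u + cnj b *\<^sub>C v"
  have vu: "inner_A A v u = cnj g" using inner_A_commute g_def by metis
  have "inner_A A w x = of_real s"
    unfolding w_def s_def inner_A_add_left inner_A_scaleC_left a_def[symmetric] b_def[symmetric]
    by (simp only: of_real_add complex_norm_square mult.commute)
  moreover have "0 \<le> s" by (simp add: s_def)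
  ultimately have "cmod (inner_A A w x) = s" by simp
  then have s_le: "s \<le> norm_A A w * norm_A A x"
    using inner_A_Cauchy_Schwarz[of w x] by simp
  have "inner_A A w w = (a * cnj a) * inner_A A u u + (b * cnj b) * inner_A A v v
      + (cnj a * b * g + cnj (cnj a * b * g))"
    unfolding w_def inner_A_add_left inner_A_add_right inner_A_scaleC_left inner_A_scaleC_right vu
      g_def[symmetric]
    by (simp add: algebra_simps)
  also have "\<dots> = of_real ((cmod a)\<^sup>2 * (norm_A A u)\<^sup>2 + (cmod b)\<^sup>2 * (norm_A A v)\<^sup>2
      + 2 * Re (cnj a * b * g))"
    unfolding inner_A_self complex_norm_square[symmetric] complex_add_cnj by simp
  finally have "(norm_A A w)\<^sup>2 = (cmod a)\<^sup>2 * (norm_A A u)\<^sup>2 + (cmod b)\<^sup>2 * (norm_A A v)\<^sup>2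
      + 2 * Re (cnj a * b * g)"
    unfolding inner_A_self of_real_eq_iff .
  moreover have "Re (cnj a * b * g) \<le> cmod a * cmod b * cmod g"
    using complex_Re_le_cmod[of "cnj a * b * g"] by (simp add: norm_mult)
  ultimately have w_le: "(norm_A A w)\<^sup>2 \<le> (cmod a)\<^sup>2 * (norm_A A u)\<^sup>2
      + (cmod b)\<^sup>2 * (norm_A A v)\<^sup>2 + 2 * (cmod a * cmod b * cmod g)" by simp
  \<comment> \<open>Cauchy-Schwarz with weights 1, 1, 2, proved by Lagrange's identity. The weight 2
    counts the two off-diagonal entries of the Gram matrix.\<close>
  have cs: "(p * k + q * l + 2 * (r * h))\<^sup>2 \<le> (p\<^sup>2 + q\<^sup>2 + 2 * r\<^sup>2) * (k\<^sup>2 + l\<^sup>2 + 2 * h\<^sup>2)"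
    for p q r k l h :: real
  proof -
    have "0 \<le> (p * l - q * k)\<^sup>2 + 2 * (p * h - r * k)\<^sup>2 + 2 * (q * h - r * l)\<^sup>2" by simp
    then show ?thesis by (simp add: power2_eq_square algebra_simps)
  qed
  have "((norm_A A w)\<^sup>2)\<^sup>2 \<le> ((cmod a)\<^sup>2 * (norm_A A u)\<^sup>2
      + (cmod b)\<^sup>2 * (norm_A A v)\<^sup>2 + 2 * (cmod a * cmod b * cmod g))\<^sup>2"
    by (rule power_mono[OF w_le]) simp
  also have "\<dots> \<le> s\<^sup>2 * F"
    using cs[of "(cmod a)\<^sup>2" "(norm_A A u)\<^sup>2" "(cmod b)\<^sup>2" "(norm_A A v)\<^sup>2" "cmod a * cmod b" "cmod g"]
    unfolding s_def F_def by (simp add: power_mult_distrib power2_sum algebra_simps)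
  finally have w4: "norm_A A w ^ 4 \<le> s\<^sup>2 * F" by simp
  have s0: "0 \<le> s" by (simp add: s_def)
  have "s\<^sup>2 * s\<^sup>2 = s ^ 4" by (simp flip: power_add)
  also have "\<dots> \<le> (norm_A A w * norm_A A x) ^ 4" by (rule power_mono[OF s_le s0])
  also have "\<dots> \<le> s\<^sup>2 * (norm_A A x ^ 4 * F)"
    using mult_right_mono[OF w4, of "norm_A A x ^ 4"] by (simp add: power_mult_distrib mult_ac)
  finally have "s\<^sup>2 * s\<^sup>2 \<le> s\<^sup>2 * (norm_A A x ^ 4 * F)" .
  moreover have "0 \<le> norm_A A x ^ 4 * F" by (simp add: F_def)
  ultimately have "s\<^sup>2 \<le> norm_A A x ^ 4 * F"
    by (cases "s = 0") (simp, metis mult_le_cancel_left_pos zero_less_power2)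
  then show ?thesis by (simp add: s_def F_def a_def b_def g_def)
qed

text \<open>The iteration argument of Krein and Lax: \<open>norm_A A (S x) ^ (2 ^ n) \<le> norm_A A ((S ^^ (2 ^ n)) x)\<close> when
  \<open>norm_A A x = 1\<close>, and the right-hand side grows at most like a constant times
  \<open>K ^ (2 ^ n)\<close>.\<close>

lemma A_symmetric_imp_A_bounded:
  assumes "bounded_linear S" and sym: "\<And>x y. inner_A A (S x) y = inner_A A x (S y)"
  shows "\<exists>K. \<forall>x. norm_A A x = 1 \<longrightarrow> norm_A A (S x) \<le> K"
proof -
  obtain K where K: "K > 0" "\<And>x. norm (S x) \<le> norm x * K"
    using bounded_linear.pos_bounded[OF assms(1)] by blast
  obtain c where c: "c \<ge> 0" "\<And>x. norm_A A x \<le> c * norm x" using norm_A_le_norm by blast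
  have sym_pow: "inner_A A ((S ^^ k) x) y = inner_A A x ((S ^^ k) y)" for k x y
    by (induction k arbitrary: x y) (simp_all add: sym funpow_swap1)
  have pow_le: "norm ((S ^^ k) x) \<le> K ^ k * norm x" for k x
  proof (induction k)
    case (Suc k)
    have "norm ((S ^^ Suc k) x) \<le> norm ((S ^^ k) x) * K" using K(2) by simp
    also have "\<dots> \<le> (K ^ k * norm x) * K" using Suc K(1) by (intro mult_right_mono) auto
    finally show ?case by (simp add: mult_ac)
  qed simp
  have "norm_A A (S x) \<le> K" if x: "norm_A A x = 1" for x
  proof (rule ccontr)
    assume "\<not> norm_A A (S x) \<le> K"
    define q where "q = norm_A A (S x) / K"
    have q: "1 < q" using \<open>\<not> norm_A A (S x) \<le> K\<close> K(1) by (simp add: q_def)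
    have pow: "norm_A A (S x) ^ (2 ^ n) \<le> norm_A A ((S ^^ (2 ^ n)) x)" for n
    proof (induction n)
      case (Suc n)
      have "norm_A A (S x) ^ (2 ^ Suc n) = (norm_A A (S x) ^ (2 ^ n))\<^sup>2"
        by (simp flip: power_mult add: mult.commute)
      also have "\<dots> \<le> (norm_A A ((S ^^ (2 ^ n)) x))\<^sup>2"
        by (rule power_mono[OF Suc]) (simp add: norm_A_nonneg)
      also have "\<dots> = cmod (inner_A A ((S ^^ (2 ^ n)) x) ((S ^^ (2 ^ n)) x))"
        by (simp add: inner_A_self norm_power)
      also have "\<dots> = cmod (inner_A A ((S ^^ (2 ^ Suc n)) x) x)"
        by (simp add: sym_pow[symmetric] funpow_add mult_2)
      also have "\<dots> \<le> norm_A A ((S ^^ (2 ^ Suc n)) x)"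
        using inner_A_Cauchy_Schwarz[of "(S ^^ (2 ^ Suc n)) x" x] x by simp
      finally show ?case .
    qed simp
    obtain N where N: "c * norm x < q ^ N" using real_arch_pow[OF q] by blast
    \<comment> \<open>The iteration only controls exponents that are powers of two.\<close>
    have "q ^ N \<le> q ^ (2 ^ N)"
      using q by (intro power_increasing) (auto intro: less_imp_le)
    also have "\<dots> \<le> norm_A A ((S ^^ (2 ^ N)) x) / K ^ (2 ^ N)"
      unfolding q_def power_divide using pow K(1) by (intro divide_right_mono) auto
    also have "\<dots> \<le> (c * (K ^ (2 ^ N) * norm x)) / K ^ (2 ^ N)"
      using c(2)[of "(S ^^ (2 ^ N)) x"] mult_left_mono[OF pow_le c(1), of "2 ^ N" x] K(1)
      by (intro divide_right_mono) auto
    also have "\<dots> = c * norm x" using K(1) by simp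
    finally show False using N by simp
  qed
  then show ?thesis by blast
qed

text \<open>Makes the suprema range over a nonempty set. If \<open>A x\<close> is nonzero, pairing
  \<open>x\<close> with \<open>A x\<close> and Cauchy-Schwarz show that \<open>x\<close> has nonzero
  seminorm and can be normalized.\<close>

lemma norm_A_eq_1_exists:
  assumes "A \<noteq> (\<lambda>x. 0)"
  shows "\<exists>x. norm_A A x = 1"
proof -
  obtain x where x: "A x \<noteq> 0" using assms by blast
  have "inner_A A x (A x) = cinner (A x) (A x)" by (simp add: inner_A_def)
  then have "inner_A A x (A x) \<noteq> 0" using x by (metis Re_cinner inner_eq_zero_iff zero_complex.sel(1))
  then have "norm_A A x \<noteq> 0" using inner_A_Cauchy_Schwarz[of x "A x"] by auto
  then have pos: "norm_A A x > 0" using norm_A_nonneg[of x] by simp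
  define y where "y = complex_of_real (1 / norm_A A x) *\<^sub>C x"
  have "inner_A A y y = 1"
    unfolding y_def inner_A_scaleC_left inner_A_scaleC_right
    unfolding inner_A_self using pos by (simp add: power2_eq_square)
  then have "norm_A A y = 1" by (simp add: norm_A_def)
  then show ?thesis by blast
qed

end

section \<open>The bound for the A-Davis-Wielandt radius\<close>

theorem corollary2p1:
  fixes A T :: "'a::complex_hilbert \<Rightarrow> 'a"
  assumes "positive_op A" and "A \<noteq> (\<lambda>x. 0)" and "T \<in> B_A A"
  shows "domega_A A T \<le>
    root 4 (omega_A A (\<lambda>x. ((sharp A T \<circ> T) ^^ 2) x + ((sharp A T \<circ> T) ^^ 4) x)
            + 2 * (omega_A A (sharp A T \<circ> T \<circ> T))\<^sup>2)"
proof -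
  note A = assms(1)
  note CS = inner_A_Cauchy_Schwarz[OF A]
  note self = inner_A_self[OF A]
  have T: "bounded_clinear T" using assms(3) by (simp add: B_A_def)
  note X = sharp_properties[OF A assms(3)]
  define S where "S = sharp A T \<circ> T"
  have S: "bounded_linear S"
    unfolding S_def by (intro bounded_clinear_imp_bounded_linear bounded_clinear_compose X(1) T)
  have adj: "inner_A A x (sharp A T y) = inner_A A (T x) y" for x y
  proof -
    have "inner_A A x (sharp A T y) = cinner x ((A \<circ> sharp A T) y)"
      by (simp add: inner_A_def positive_op_symmetric[OF A])
    also have "\<dots> = inner_A A (T x) y"
      by (simp add: X(2) inner_A_def positive_op_symmetric[OF A] cinner_cadjoint[OF T])
    finally show ?thesis .
  qed
  have S_right: "inner_A A x (S y) = inner_A A (T x) (T y)" for x y by (simp add: S_def adj)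
  have S_left: "inner_A A (S x) y = inner_A A (T x) (T y)" for x y
    by (metis S_right inner_A_commute[OF A])
  have S_sym: "inner_A A (S x) y = inner_A A x (S y)" for x y by (simp add: S_left S_right)
  have cross: "cmod (inner_A A (S (T x)) x) = cmod (inner_A A (T x) (S x))" for x
    by (simp add: S_left S_right)
  have norm_T: "(norm_A A (T x))\<^sup>2 = cmod (inner_A A (S x) x)" for x
    by (simp add: S_left self norm_power)
  have norm_S: "(norm_A A (S x))\<^sup>2 = cmod (inner_A A (S (S x)) x)" for x
    by (simp add: S_sym self norm_power)
  \<comment> \<open>By symmetry of \<open>S\<close> both forms are nonnegative reals, so the modulus
    of their sum is the sum of two squared seminorms.\<close>
  have quad: "cmod (inner_A A ((S ^^ 2) x + (S ^^ 4) x) x)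
      = (norm_A A (S x))\<^sup>2 + (norm_A A (S (S x)))\<^sup>2" for x
  proof -
    have "inner_A A ((S ^^ 2) x + (S ^^ 4) x) x
        = of_real ((norm_A A (S x))\<^sup>2 + (norm_A A (S (S x)))\<^sup>2)"
      by (simp add: inner_A_add_left[OF A] S_sym self numeral_eq_Suc flip: of_real_power)
    then show ?thesis by (simp only: norm_of_real) simp
  qed
  define \<Omega>\<^sub>1 \<Omega>\<^sub>2 where "\<Omega>\<^sub>1 = omega_A A (\<lambda>x. (S ^^ 2) x + (S ^^ 4) x)"
    and "\<Omega>\<^sub>2 = omega_A A (S \<circ> T)"
  obtain K where K: "\<And>x. norm_A A x = 1 \<Longrightarrow> norm_A A (S x) \<le> K"
    using A_symmetric_imp_A_bounded[OF A S S_sym] by blast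
  \<comment> \<open>The bound is obtained for \<open>S \<circ> S\<close> directly, since
    \<open>S x\<close> need not have unit seminorm. \<open>K\<close> and \<open>L\<close> make the
    sets under the suprema bounded above.\<close>
  have "\<exists>L. \<forall>x. norm_A A x = 1 \<longrightarrow> norm_A A ((S \<circ> S) x) \<le> L"
    by (rule A_symmetric_imp_A_bounded[OF A])
      (use S S_sym in \<open>auto simp: o_def intro: bounded_linear_compose\<close>)
  then obtain L where L: "\<And>x. norm_A A x = 1 \<Longrightarrow> norm_A A (S (S x)) \<le> L" by auto
  have T_le: "(norm_A A (T x))\<^sup>2 \<le> norm_A A (S x)" if "norm_A A x = 1" for x
    using CS[of "S x" x] that by (simp add: norm_T)
  have S_le: "(norm_A A (S x))\<^sup>2 \<le> norm_A A (S (S x))" if "norm_A A x = 1" for x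
    using CS[of "S (S x)" x] that by (simp add: norm_S)
  have le\<^sub>1: "(norm_A A (S x))\<^sup>2 + (norm_A A (S (S x)))\<^sup>2 \<le> \<Omega>\<^sub>1" if x: "norm_A A x = 1" for x
    unfolding \<Omega>\<^sub>1_def omega_A_def quad
  proof (rule cSUP_upper)
    show "bdd_above ((\<lambda>x. (norm_A A (S x))\<^sup>2 + (norm_A A (S (S x)))\<^sup>2) ` {x. norm_A A x = 1})"
      by (rule bdd_aboveI2[where M = "K\<^sup>2 + L\<^sup>2"])
        (auto intro!: add_mono power_mono K L norm_A_nonneg[OF A])
  qed (use x in simp)
  have le\<^sub>2: "cmod (inner_A A (T x) (S x)) \<le> \<Omega>\<^sub>2" if x: "norm_A A x = 1" for x
    unfolding \<Omega>\<^sub>2_def omega_A_def o_apply cross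
  proof (rule cSUP_upper)
    show "bdd_above ((\<lambda>x. cmod (inner_A A (T x) (S x))) ` {x. norm_A A x = 1})"
    proof (rule bdd_aboveI2)
      fix x assume "x \<in> {x. norm_A A x = 1}"
      then have x: "norm_A A x = 1" by simp
      have "norm_A A (T x) \<le> sqrt K"
        using T_le[OF x] K[OF x] by (intro real_le_rsqrt) simp
      then have "norm_A A (T x) * norm_A A (S x) \<le> sqrt K * K"
        using K[OF x] norm_A_nonneg[OF A] by (smt (verit) mult_mono)
      with CS[of "T x" "S x"] show "cmod (inner_A A (T x) (S x)) \<le> sqrt K * K" by simp
    qed
  qed (use x in simp)
  have "sqrt ((cmod (inner_A A (T x) x))\<^sup>2 + norm_A A (T x) ^ 4) \<le> root 4 (\<Omega>\<^sub>1 + 2 * \<Omega>\<^sub>2\<^sup>2)"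
    if x: "norm_A A x = 1" for x
  proof -
    define r where "r = (cmod (inner_A A (T x) x))\<^sup>2 + norm_A A (T x) ^ 4"
    \<comment> \<open>Rewrites the second summand of \<open>r\<close> as a squared product with
      \<open>x\<close>, so that \<open>Bessel_Frobenius\<close> applies to \<open>T x\<close> and
      \<open>S x\<close>.\<close>
    have "norm_A A (T x) ^ 4 = ((norm_A A (T x))\<^sup>2)\<^sup>2" by simp
    then have T4: "norm_A A (T x) ^ 4 = (cmod (inner_A A (S x) x))\<^sup>2" by (simp only: norm_T)
    have "norm_A A (T x) ^ 4 \<le> (norm_A A (S x))\<^sup>2" "norm_A A (S x) ^ 4 \<le> (norm_A A (S (S x)))\<^sup>2"
      using power_mono[OF T_le[OF x], of 2] power_mono[OF S_le[OF x], of 2] by simp_all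
    moreover have "(cmod (inner_A A (T x) (S x)))\<^sup>2 \<le> \<Omega>\<^sub>2\<^sup>2"
      using le\<^sub>2[OF x] by (intro power_mono) auto
    moreover have "r\<^sup>2 \<le> norm_A A (T x) ^ 4 + norm_A A (S x) ^ 4
        + 2 * (cmod (inner_A A (T x) (S x)))\<^sup>2"
      using Bessel_Frobenius[OF A, of "T x" x "S x"] x by (simp add: r_def T4)
    ultimately have "r\<^sup>2 \<le> \<Omega>\<^sub>1 + 2 * \<Omega>\<^sub>2\<^sup>2" using le\<^sub>1[OF x] by linarith
    moreover have "0 \<le> r" by (simp add: r_def)
    have "sqrt r ^ 4 = ((sqrt r)\<^sup>2)\<^sup>2" by simp
    with \<open>0 \<le> r\<close> have "root 4 (r\<^sup>2) = sqrt r"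
      by (intro real_root_pos_unique) (simp_all only: real_sqrt_ge_zero real_sqrt_pow2 zero_less_numeral)
    ultimately show ?thesis
      unfolding r_def[symmetric] by (metis real_root_le_mono zero_less_numeral)
  qed
  then have "domega_A A T \<le> root 4 (\<Omega>\<^sub>1 + 2 * \<Omega>\<^sub>2\<^sup>2)"
    unfolding domega_A_def using norm_A_eq_1_exists[OF A assms(2)] by (intro cSUP_least) auto
  then show ?thesis by (simp add: \<Omega>\<^sub>1_def \<Omega>\<^sub>2_def S_def)
qed

end
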